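(* Let $n\ge 1$ and define $\mu:\mathbb{P}_n\times\mathbb{P}_n\to\mathbb{P}_n$ by $\mu(A,B)=A*B$, where $$A*B=\frac{1}{\sqrt{\lambda_{\min}}+\sqrt{\lambda_{\max}}}\left(B+\sqrt{\lambda_{\min}\lambda_{\max}}\,A\right)$$ and $\lambda_{\min},\lambda_{\max}$ are the smallest and largest eigenvalues of $BA^{-1}$. Then: (i) for all $A,B\in\mathbb{P}_n$, $\mu(A,B)$ is a Thompson metric midpoint of $(A,B)$, i.e. $d_\infty(A,\mu(A,B))=d_\infty(B,\mu(A,B))=\tfrac12 d_\infty(A,B)$; (ii) $\mu$ is continuous; (iii) $\mu$ is symmetric: $\mu(A,B)=\mu(B,A)$ for all $A,B\in\mathbb{P}_n$; (iv) $\mu$ is affine-invariant: $\mu(XAX^*,XBX^* )=X\mu(A,B)X^*$ for all $A,B\in\mathbb{P}_n$ and all $X\in GL(n)$; (v) if $A,B\in\mathbb{P}_n$ and $A\preceq B$, then $A\preceq\mu(A,B)\preceq B$; (vi) the extremal eigenvalues of $\mu(I,\Sigma)$ depend monotonically on $\Sigma\in\mathbb{P}_n$: if $\Sigma_1,\Sigma_2\in\mathbb{P}_n$ and $\Sigma_1\preceq\Sigma_2$, then $\lambda_{\min}(\mu(I,\Sigma_1))\le\lambda_{\min}(\mu(I,\Sigma_2))$ and $\lambda_{\max}(\mu(I,\Sigma_1))\le\lambda_{\max}(\mu(I,\Sigma_2))$.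
   Context: $\mathbb{P}_n$ is the set of $n\times n$ complex Hermitian positive definite matrices; $GL(n)$ is the group of invertible $n\times n$ complex matrices; $X^*$ is the conjugate transpose of $X$. $\preceq$ is the Löwner order on Hermitian matrices: $A\preceq B$ iff $B-A$ is positive semidefinite. For $A,B\in\mathbb{P}_n$ the eigenvalues of $BA^{-1}$ are real and positive, equal to those of $A^{-1/2}BA^{-1/2}$. The Thompson metric on $\mathbb{P}_n$ is $d_\infty(A,B)=\log\max\{\lambda_{\max}(AB^{-1}),\lambda_{\max}(BA^{-1})\}$, where $\lambda_{\max}$ denotes the largest eigenvalue (and $\lambda_{\min}$ the smallest). *)

theory Defs
  imports "HOL-Analysis.Analysis"
begin

text \<open>The dimension \<open>n \<ge> 1\<close> is \<open>CARD('n)\<close> for an arbitrary finite index type \<open>'n\<close>.\<close>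

definition conj_transpose :: "complex ^ 'n ^ 'm \<Rightarrow> complex ^ 'm ^ 'n" where
  "conj_transpose X = (\<chi> i j. cnj (X $ j $ i))"

definition hermitian :: "complex ^ 'n ^ 'n \<Rightarrow> bool" where
  "hermitian A \<longleftrightarrow> conj_transpose A = A"

definition quad_form :: "complex ^ 'n ^ 'n \<Rightarrow> complex ^ 'n \<Rightarrow> complex" where
  "quad_form A x = (\<Sum>i\<in>UNIV. cnj (x $ i) * (A *v x) $ i)"

text \<open>The quadratic form of a Hermitian matrix is real-valued, so nothing is lost by taking \<open>Re\<close>.\<close>

definition pos_semidef :: "complex ^ 'n ^ 'n \<Rightarrow> bool" where
  "pos_semidef A \<longleftrightarrow> hermitian A \<and> (\<forall>x. 0 \<le> Re (quad_form A x))"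

definition PD :: "(complex ^ 'n ^ 'n) set" where
  "PD = {A. hermitian A \<and> (\<forall>x. x \<noteq> 0 \<longrightarrow> 0 < Re (quad_form A x))}"

definition loewner_le :: "complex ^ 'n ^ 'n \<Rightarrow> complex ^ 'n ^ 'n \<Rightarrow> bool"  (infix \<open>\<preceq>\<^sub>L\<close> 50) where
  "A \<preceq>\<^sub>L B \<longleftrightarrow> pos_semidef (B - A)"

definition eigenvalue :: "complex ^ 'n ^ 'n \<Rightarrow> complex \<Rightarrow> bool" where
  "eigenvalue A c \<longleftrightarrow> (\<exists>v. v \<noteq> 0 \<and> A *v v = c *s v)"

text \<open>Used only for matrices all of whose eigenvalues are real: Hermitian matrices, and
  \<open>B ** matrix_inv A\<close> with \<open>A\<close> and \<open>B\<close> positive definite.\<close>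

definition eig_min :: "complex ^ 'n ^ 'n \<Rightarrow> real" where
  "eig_min A = Min {l. eigenvalue A (complex_of_real l)}"

definition eig_max :: "complex ^ 'n ^ 'n \<Rightarrow> real" where
  "eig_max A = Max {l. eigenvalue A (complex_of_real l)}"

definition thompson_dist :: "complex ^ 'n ^ 'n \<Rightarrow> complex ^ 'n ^ 'n \<Rightarrow> real" where
  "thompson_dist A B = ln (max (eig_max (A ** matrix_inv B)) (eig_max (B ** matrix_inv A)))"

definition star_mean :: "complex ^ 'n ^ 'n \<Rightarrow> complex ^ 'n ^ 'n \<Rightarrow> complex ^ 'n ^ 'n" where
  "star_mean A B =
     (let lmin = eig_min (B ** matrix_inv A); lmax = eig_max (B ** matrix_inv A)
      in (1 / (sqrt lmin + sqrt lmax)) *\<^sub>R (B + sqrt (lmin * lmax) *\<^sub>R A))"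

end

theory Submission
  imports Defs
begin

text \<open>The real part of the Hermitian form of \<open>A\<close> is \<open>x \<bullet> A x\<close> for the real inner product. A maximizer
  of the Rayleigh quotient of \<open>B\<close> relative to \<open>A\<close> lies in the kernel of a semidefinite form, so
  \<open>\<lambda>\<^sub>m\<^sub>a\<^sub>x (B A\<^sup>-\<^sup>1) \<le> t\<close> iff \<open>B \<preceq> t A\<close>, and exchanging \<open>A\<close> and \<open>B\<close> gives the dual
  statement for \<open>\<lambda>\<^sub>m\<^sub>i\<^sub>n\<close>. Consequently the extremal eigenvalues of \<open>(A * B) A\<^sup>-\<^sup>1\<close> are the square roots
  of those of \<open>B A\<^sup>-\<^sup>1\<close>, from which every assertion but continuity is read off.\<close>

section \<open>Real inner product and conjugate transpose\<close>

lemma matrix_vector_mult_scaleR_right: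
  fixes A :: "complex ^ 'n ^ 'm"
  shows "A *v (c *\<^sub>R x) = c *\<^sub>R (A *v x)"
  by (simp add: matrix_vector_mult_def vec_eq_iff scaleR_sum_right)

lemma matrix_vector_mult_scaleR_left:
  fixes A :: "complex ^ 'n ^ 'm"
  shows "(c *\<^sub>R A) *v x = c *\<^sub>R (A *v x)"
  by (simp add: matrix_vector_mult_def vec_eq_iff scaleR_sum_right)

lemma of_real_vector_smult:
  fixes v :: "complex ^ 'n"
  shows "complex_of_real c *s v = c *\<^sub>R v"
  by (simp add: vec_eq_iff scaleR_conv_of_real[where 'a = complex])

lemma inner_complex_eq: "inner (z::complex) w = Re (cnj z * w)"
  by (simp add: inner_complex_def)

lemma Re_quad_form: "Re (quad_form A x) = inner x (A *v x)"
  by (simp add: quad_form_def inner_vec_def inner_complex_eq)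

text \<open>Passing to real parts keeps \<open>conj_transpose X\<close> as the adjoint of
  \<open>X\<close>, so Hermitian matrices become self-adjoint operators on a real inner product
  space.\<close>

lemma inner_conj_transpose:
  fixes X :: "complex ^ 'n ^ 'm"
  shows "inner (conj_transpose X *v x) y = inner x (X *v y)"
proof -
  have "inner (conj_transpose X *v x) y
      = (\<Sum>i\<in>UNIV. \<Sum>j\<in>UNIV. inner (cnj (X $ j $ i) * x $ j) (y $ i))"
    by (simp add: inner_vec_def matrix_vector_mult_def conj_transpose_def inner_sum_left)
  also have "\<dots> = (\<Sum>j\<in>UNIV. \<Sum>i\<in>UNIV. inner (cnj (X $ j $ i) * x $ j) (y $ i))"
    by (rule sum.swap)
  also have "\<dots> = (\<Sum>j\<in>UNIV. \<Sum>i\<in>UNIV. inner (x $ j) (X $ j $ i * y $ i))"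
    by (simp add: inner_complex_eq algebra_simps)
  also have "\<dots> = inner x (X *v y)"
    by (simp add: inner_vec_def matrix_vector_mult_def inner_sum_right)
  finally show ?thesis .
qed

lemma hermitian_inner:
  "hermitian A \<Longrightarrow> inner (A *v x) y = inner x (A *v y)"
  by (metis hermitian_def inner_conj_transpose)

lemma conj_transpose_add: "conj_transpose (A + B) = conj_transpose A + conj_transpose B"
  by (simp add: conj_transpose_def vec_eq_iff)

lemma conj_transpose_diff: "conj_transpose (A - B) = conj_transpose A - conj_transpose B"
  by (simp add: conj_transpose_def vec_eq_iff)

lemma conj_transpose_scaleR: "conj_transpose (c *\<^sub>R A) = c *\<^sub>R conj_transpose A"
  by (simp add: conj_transpose_def vec_eq_iff)

lemma conj_transpose_conj_transpose [simp]: "conj_transpose (conj_transpose A) = A"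
  by (simp add: conj_transpose_def vec_eq_iff)

lemma conj_transpose_mult:
  fixes A :: "complex ^ 'n ^ 'm" and B :: "complex ^ 'k ^ 'n"
  shows "conj_transpose (A ** B) = conj_transpose B ** conj_transpose A"
  by (simp add: conj_transpose_def vec_eq_iff matrix_matrix_mult_def mult.commute)

lemma conj_transpose_mat_1 [simp]: "conj_transpose (mat 1) = mat 1"
  by (simp add: conj_transpose_def vec_eq_iff mat_def)

lemma hermitian_add_scaleR:
  "hermitian A \<Longrightarrow> hermitian B \<Longrightarrow> hermitian (a *\<^sub>R A + b *\<^sub>R B)"
  by (simp add: hermitian_def conj_transpose_add conj_transpose_scaleR)

section \<open>Positive definite matrices and the Loewner order\<close>

lemma PD_iff: "A \<in> PD \<longleftrightarrow> hermitian A \<and> (\<forall>x. x \<noteq> 0 \<longrightarrow> 0 < inner x (A *v x))"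
  by (simp add: PD_def Re_quad_form)

lemma PD_hermitian: "A \<in> PD \<Longrightarrow> hermitian A"
  by (simp add: PD_iff)

lemma PD_pos: "A \<in> PD \<Longrightarrow> x \<noteq> 0 \<Longrightarrow> 0 < inner x (A *v x)"
  by (simp add: PD_iff)

lemma PD_nonneg: "A \<in> PD \<Longrightarrow> 0 \<le> inner x (A *v x)"
  by (cases "x = 0") (auto dest: PD_pos less_imp_le)

lemma loewner_le_iff:
  assumes "hermitian A" "hermitian B"
  shows "A \<preceq>\<^sub>L B \<longleftrightarrow> (\<forall>x. inner x (A *v x) \<le> inner x (B *v x))"
  using assms
  by (simp add: loewner_le_def pos_semidef_def hermitian_def conj_transpose_diff Re_quad_form
      matrix_vector_mult_diff_rdistrib inner_diff_right)

lemma PD_add_scaleR: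
  assumes "A \<in> PD" "B \<in> PD" "a > 0" "b > 0"
  shows "a *\<^sub>R A + b *\<^sub>R B \<in> PD"
  using assms
  by (simp add: PD_iff hermitian_add_scaleR matrix_vector_mult_add_rdistrib
      matrix_vector_mult_scaleR_left inner_add_right add_pos_pos)

lemma mat_1_PD: "mat 1 \<in> PD"
  by (simp add: PD_iff hermitian_def)

lemma PD_invertible:
  assumes "A \<in> PD" shows "invertible A"
proof -
  have "x = 0" if "A *v x = 0" for x
    using PD_pos[OF assms, of x] that by auto
  then show ?thesis
    by (simp add: invertible_left_inverse matrix_left_invertible_ker)
qed

lemma PD_congruence:
  assumes "A \<in> PD" "invertible X"
  shows "X ** A ** conj_transpose X \<in> PD"
proof -
  obtain Y where Y: "X ** Y = mat 1" using assms(2) by (auto simp: invertible_def)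
  have inj: "x = 0" if "conj_transpose X *v x = 0" for x
  proof -
    have "conj_transpose Y ** conj_transpose X = mat 1"
      using Y by (metis conj_transpose_mult conj_transpose_mat_1)
    then have "x = conj_transpose Y *v (conj_transpose X *v x)"
      by (simp add: matrix_vector_mul_assoc)
    then show ?thesis using that by simp
  qed
  have "hermitian (X ** A ** conj_transpose X)"
    using PD_hermitian[OF assms(1)]
    by (simp add: hermitian_def conj_transpose_mult matrix_mul_assoc)
  moreover have "0 < inner x ((X ** A ** conj_transpose X) *v x)" if "x \<noteq> 0" for x
    using PD_pos[OF assms(1), of "conj_transpose X *v x"] inj[of x] that
    by (auto simp: inner_conj_transpose matrix_vector_mul_assoc matrix_mul_assoc)
  ultimately show ?thesis by (simp add: PD_iff)
qed

lemma inner_congruence: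
  fixes X :: "complex ^ 'n ^ 'm"
  shows "inner x ((X ** A ** conj_transpose X) *v x)
    = inner (conj_transpose X *v x) (A *v (conj_transpose X *v x))"
  by (simp add: inner_conj_transpose matrix_vector_mul_assoc matrix_mul_assoc)

section \<open>Generalized eigenvalues of a pair of matrices\<close>

lemma matrix_inv_inverse:
  fixes A :: "complex ^ 'n ^ 'n"
  assumes "invertible A"
  shows "A ** matrix_inv A = mat 1" "matrix_inv A ** A = mat 1"
  using someI_ex[OF assms[unfolded invertible_def]] by (simp_all add: matrix_inv_def)

text \<open>The substitution \<open>v = A *v w\<close> removes the inverse. The product
  \<open>B ** matrix_inv A\<close> is in general not Hermitian, whereas the resulting pencil
  equation involves only \<open>A\<close> and \<open>B\<close> themselves.\<close>

lemma eigenvalue_mult_matrix_inv: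
  fixes A B :: "complex ^ 'n ^ 'n"
  assumes "invertible A"
  shows "eigenvalue (B ** matrix_inv A) (complex_of_real l)
    \<longleftrightarrow> (\<exists>w. w \<noteq> 0 \<and> B *v w = l *\<^sub>R (A *v w))" (is "?L \<longleftrightarrow> ?R")
proof
  have AI: "A ** matrix_inv A = mat 1" and IA: "matrix_inv A ** A = mat 1"
    using assms by (simp_all add: matrix_inv_inverse)
  show ?R if L: ?L
  proof -
    obtain v where v: "v \<noteq> 0" "(B ** matrix_inv A) *v v = l *\<^sub>R v"
      using L by (auto simp: eigenvalue_def of_real_vector_smult)
    have Av: "A *v (matrix_inv A *v v) = v"
      by (simp add: matrix_vector_mul_assoc AI)
    then have "matrix_inv A *v v \<noteq> 0" using v(1) by auto
    moreover have "B *v (matrix_inv A *v v) = l *\<^sub>R (A *v (matrix_inv A *v v))"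
      using v(2) Av by (simp add: matrix_vector_mul_assoc)
    ultimately show ?thesis by blast
  qed
  show ?L if R: ?R
  proof -
    obtain w where w: "w \<noteq> 0" "B *v w = l *\<^sub>R (A *v w)" using R by blast
    have wA: "matrix_inv A *v (A *v w) = w"
      by (simp add: matrix_vector_mul_assoc IA)
    then have "A *v w \<noteq> 0" using w(1) by auto
    moreover have "(B ** matrix_inv A) *v (A *v w) = l *\<^sub>R (A *v w)"
      using w(2) wA by (simp flip: matrix_vector_mul_assoc)
    ultimately show ?thesis unfolding eigenvalue_def of_real_vector_smult by blast
  qed
qed

text \<open>Eigenvectors of the pencil for distinct eigenvalues are orthogonal for the inner product
  defined by \<open>A\<close>, hence linearly independent.\<close>
lemma finite_real_eigenvalues:
  assumes A: "A \<in> PD" and B: "hermitian B"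
  shows "finite {l. eigenvalue (B ** matrix_inv A) (complex_of_real l)}" (is "finite ?S")
proof -
  have "\<forall>l\<in>?S. \<exists>w. w \<noteq> 0 \<and> B *v w = l *\<^sub>R (A *v w)"
    by (simp add: eigenvalue_mult_matrix_inv[OF PD_invertible[OF A]])
  then obtain w where w0: "\<And>l. l \<in> ?S \<Longrightarrow> w l \<noteq> 0"
    and w: "\<And>l. l \<in> ?S \<Longrightarrow> B *v w l = l *\<^sub>R (A *v w l)"
    by metis
  have orth: "inner (w k) (A *v w l) = 0" if "k \<in> ?S" "l \<in> ?S" "k \<noteq> l" for k l
  proof -
    have "l * inner (w k) (A *v w l) = inner (w k) (B *v w l)" using w that by simp
    also have "\<dots> = inner (B *v w k) (w l)" using hermitian_inner[OF B] by simp
    also have "\<dots> = k * inner (w k) (A *v w l)"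
      using w that hermitian_inner[OF PD_hermitian[OF A]] by simp
    finally show ?thesis using that(3) by simp
  qed
  have inj: "inj_on w ?S"
  proof (rule inj_onI)
    fix k l assume kl: "k \<in> ?S" "l \<in> ?S" "w k = w l"
    then show "k = l" using orth[of k l] PD_pos[OF A w0[of l]] by fastforce
  qed
  have "independent (w ` ?S)"
  proof
    assume "dependent (w ` ?S)"
    then obtain t u v where t: "finite t" "t \<subseteq> w ` ?S" "(\<Sum>x\<in>t. u x *\<^sub>R x) = 0"
      and v: "v \<in> t" "u v \<noteq> 0"
      unfolding dependent_explicit by blast
    \<comment> \<open>Pairing the linear relation with \<open>A *v v\<close> annihilates every term
      except that of \<open>v\<close>.\<close>
    have "0 = inner (\<Sum>x\<in>t. u x *\<^sub>R x) (A *v v)" using t by simp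
    also have "\<dots> = (\<Sum>x\<in>t. u x * inner x (A *v v))" by (simp add: inner_sum_left)
    also have "\<dots> = (\<Sum>x\<in>t. if x = v then u v * inner v (A *v v) else 0)"
    proof (rule sum.cong[OF refl])
      fix x assume "x \<in> t"
      then obtain k l where "k \<in> ?S" "l \<in> ?S" "x = w k" "v = w l" using t(2) v(1) by blast
      then show "u x * inner x (A *v v) = (if x = v then u v * inner v (A *v v) else 0)"
        using orth by auto
    qed
    also have "\<dots> = u v * inner v (A *v v)" using t(1) v(1) by simp
    finally have "inner v (A *v v) = 0" using v(2) by simp
    moreover obtain l where "l \<in> ?S" "v = w l" using v(1) t(2) by (meson image_iff subsetD)
    ultimately show False using PD_pos[OF A w0[of l]] by simp
  qed
  then have "finite (w ` ?S)" by (rule independent_imp_finite)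
  then show ?thesis using inj finite_imageD by blast
qed

section \<open>Extremal eigenvalues through quadratic forms\<close>

lemma continuous_on_matrix_vector_mult [continuous_intros]:
  fixes f :: "'a::topological_space \<Rightarrow> complex ^ 'n ^ 'm"
  assumes "continuous_on S f" "continuous_on S g"
  shows "continuous_on S (\<lambda>x. f x *v g x)"
  unfolding matrix_vector_mult_def
  by (intro continuous_on_vec_lambda continuous_intros assms)

text \<open>A zero of a nonnegative form is a minimum, so its first variation vanishes. Otherwise a
  small step from \<open>x\<close> against the direction \<open>C *v x\<close> would make the form
  negative.\<close>

lemma pos_semidef_kernel:
  assumes C: "hermitian C" and nonneg: "\<And>x. 0 \<le> inner x (C *v x)"
    and x: "inner x (C *v x) = 0"
  shows "C *v x = 0"
proof (rule ccontr)
  define y where "y = C *v x"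
  define a where "a = inner y y"
  define b where "b = inner y (C *v y)"
  assume "C *v x \<noteq> 0"
  then have a: "a > 0" by (simp add: a_def y_def)
  have b: "b \<ge> 0" using nonneg by (simp add: b_def)
  have "inner x (C *v y) = a" using hermitian_inner[OF C, of x y] by (simp add: a_def y_def)
  then have "inner (x + t *\<^sub>R y) (C *v (x + t *\<^sub>R y)) = 2 * t * a + t * t * b" for t
    using x by (simp add: matrix_vector_right_distrib matrix_vector_mult_scaleR_right
        inner_add_left inner_add_right algebra_simps a_def b_def flip: y_def)
  then have q: "0 \<le> 2 * t * a + t * t * b" for t using nonneg by metis
  \<comment> \<open>The denominator \<open>b + 1\<close> is positive even when \<open>b = 0\<close>,
    and it gives \<open>t * b \<ge> - a\<close>, so the linear term \<open>2 * a\<close>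
    dominates.\<close>
  define t where "t = - a / (b + 1)"
  have t: "t < 0" and tb: "t * b \<ge> - a"
    using a b by (auto simp: t_def divide_simps)
  then have "2 * a + t * b > 0" using a by linarith
  then have "t * (2 * a + t * b) < 0" using t by (simp add: mult_neg_pos)
  then show False using q[of t] by (simp add: algebra_simps)
qed

lemma eig_max_attained_bound:
  fixes A B :: "complex ^ 'n ^ 'n"
  assumes A: "A \<in> PD" and B: "hermitian B"
  obtains w M where "w \<noteq> 0" "B *v w = M *\<^sub>R (A *v w)"
    "\<And>x. inner x (B *v x) \<le> M * inner x (A *v x)"
proof -
  let ?S = "sphere (0::complex ^ 'n) 1"
  let ?q = "\<lambda>x. inner x (B *v x) / inner x (A *v x)"
  have "inner x (A *v x) \<noteq> 0" if "x \<in> ?S" for x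
    using PD_pos[OF A, of x] that by fastforce
  then have "continuous_on ?S ?q" by (intro continuous_intros) auto
  moreover have "?S \<noteq> {}" by simp
  ultimately obtain w where w: "w \<in> ?S" and max: "\<And>y. y \<in> ?S \<Longrightarrow> ?q y \<le> ?q w"
    using continuous_attains_sup[of ?S ?q] by auto
  define M where "M = ?q w"
  have w0: "w \<noteq> 0" using w by auto
  have bound: "inner x (B *v x) \<le> M * inner x (A *v x)" for x
  proof (cases "x = 0")
    case False
    have "?q (x /\<^sub>R norm x) \<le> M" using max[of "x /\<^sub>R norm x"] False by (simp add: M_def)
    then have "?q x \<le> M" using False by (simp add: matrix_vector_mult_scaleR_right)
    then show ?thesis using PD_pos[OF A False] by (simp add: divide_simps)
  qed simp
  \<comment> \<open>The form of \<open>?C\<close> is nonnegative by \<open>bound\<close> and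
    vanishes at the maximizer \<open>w\<close>, so the kernel lemma turns equality of forms into the
    eigenvector equation.\<close>
  let ?C = "M *\<^sub>R A + (-1) *\<^sub>R B"
  have C: "?C *v x = M *\<^sub>R (A *v x) - B *v x" for x
    by (simp only: matrix_vector_mult_add_rdistrib matrix_vector_mult_scaleR_left) simp
  have "?C *v w = 0"
  proof (rule pos_semidef_kernel)
    show "hermitian ?C" by (intro hermitian_add_scaleR PD_hermitian A B)
    show "0 \<le> inner x (?C *v x)" for x
      using bound[of x] by (simp only: C inner_diff_right inner_scaleR_right)
    show "inner w (?C *v w) = 0"
      using PD_pos[OF A w0] by (simp only: C inner_diff_right inner_scaleR_right) (simp add: M_def)
  qed
  then have "B *v w = M *\<^sub>R (A *v w)" unfolding C by simp
  then show thesis using that w0 bound by blast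
qed

lemma pencil_eigenvalue_le:
  assumes A: "A \<in> PD" and w: "w \<noteq> 0" "B *v w = l *\<^sub>R (A *v w)"
    and bound: "\<And>x. inner x (B *v x) \<le> M * inner x (A *v x)"
  shows "l \<le> M"
  using bound[of w] w(2) PD_pos[OF A w(1)] by simp

text \<open>The maximal Rayleigh quotient is an eigenvalue, and evaluating the bound at any other
  eigenvector shows that none is larger. Finiteness makes \<open>Max\<close> meaningful.\<close>

lemma eig_max_pencil:
  fixes A B :: "complex ^ 'n ^ 'n"
  assumes A: "A \<in> PD" and B: "hermitian B"
  obtains w where "w \<noteq> 0" "B *v w = eig_max (B ** matrix_inv A) *\<^sub>R (A *v w)"
    "\<And>x. inner x (B *v x) \<le> eig_max (B ** matrix_inv A) * inner x (A *v x)"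
proof -
  obtain w M where w: "w \<noteq> 0" "B *v w = M *\<^sub>R (A *v w)"
    and bound: "\<And>x. inner x (B *v x) \<le> M * inner x (A *v x)"
    using eig_max_attained_bound[OF A B] by blast
  have "eig_max (B ** matrix_inv A) = M"
    unfolding eig_max_def
  proof (rule Max_eqI[OF finite_real_eigenvalues[OF A B]])
    show "M \<in> {l. eigenvalue (B ** matrix_inv A) (complex_of_real l)}"
      using w eigenvalue_mult_matrix_inv[OF PD_invertible[OF A]] by blast
    fix l assume "l \<in> {l. eigenvalue (B ** matrix_inv A) (complex_of_real l)}"
    then show "l \<le> M"
      using pencil_eigenvalue_le[OF A _ _ bound] eigenvalue_mult_matrix_inv[OF PD_invertible[OF A]]
      by blast
  qed
  then show thesis using that w bound by blast
qed

text \<open>The working criterion: it trades eigenvalues for a comparison of forms. The converse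
  direction tests the comparison on the extremal eigenvector.\<close>

lemma eig_max_le_iff:
  assumes A: "A \<in> PD" and B: "hermitian B"
  shows "eig_max (B ** matrix_inv A) \<le> t
    \<longleftrightarrow> (\<forall>x. inner x (B *v x) \<le> t * inner x (A *v x))"
proof -
  obtain w where w: "w \<noteq> 0" "B *v w = eig_max (B ** matrix_inv A) *\<^sub>R (A *v w)"
    and bound: "\<And>x. inner x (B *v x) \<le> eig_max (B ** matrix_inv A) * inner x (A *v x)"
    using eig_max_pencil[OF A B] by blast
  show ?thesis
  proof (intro iffI allI)
    show "inner x (B *v x) \<le> t * inner x (A *v x)" if "eig_max (B ** matrix_inv A) \<le> t" for x
      using bound[of x] mult_right_mono[OF that PD_nonneg[OF A, of x]] by linarith
    show "eig_max (B ** matrix_inv A) \<le> t" if "\<forall>x. inner x (B *v x) \<le> t * inner x (A *v x)"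
      using pencil_eigenvalue_le[OF A w] that by blast
  qed
qed

lemma eig_max_pos:
  assumes A: "A \<in> PD" and B: "B \<in> PD"
  shows "eig_max (B ** matrix_inv A) > 0"
proof -
  obtain w where w: "w \<noteq> 0" "B *v w = eig_max (B ** matrix_inv A) *\<^sub>R (A *v w)"
    using eig_max_pencil[OF A PD_hermitian[OF B]] by metis
  then have "0 < eig_max (B ** matrix_inv A) * inner w (A *v w)"
    using PD_pos[OF B w(1)] by simp
  then show ?thesis using PD_pos[OF A w(1)] by (simp add: zero_less_mult_iff)
qed

text \<open>\<open>B *v w = l *\<^sub>R (A *v w)\<close> is the pencil equation of the exchanged
  pair with eigenvalue \<open>1 / l\<close>, and reciprocals reverse the order of positive numbers.
  No second extremal argument is required.\<close>

lemma eig_min_eq_inverse_eig_max: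
  fixes A B :: "complex ^ 'n ^ 'n"
  assumes A: "A \<in> PD" and B: "B \<in> PD"
  shows "eig_min (B ** matrix_inv A) = 1 / eig_max (A ** matrix_inv B)"
proof -
  define M where "M = eig_max (A ** matrix_inv B)"
  have M: "M > 0" unfolding M_def by (rule eig_max_pos[OF B A])
  obtain w where w: "w \<noteq> 0" "A *v w = M *\<^sub>R (B *v w)"
    and bound: "\<And>x. inner x (A *v x) \<le> M * inner x (B *v x)"
    using eig_max_pencil[OF B PD_hermitian[OF A]] unfolding M_def by metis
  have "eig_min (B ** matrix_inv A) = 1 / M"
    unfolding eig_min_def
  proof (rule Min_eqI[OF finite_real_eigenvalues[OF A PD_hermitian[OF B]]])
    have "B *v w = (1 / M) *\<^sub>R (A *v w)" using w(2) M by simp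
    then show "1 / M \<in> {l. eigenvalue (B ** matrix_inv A) (complex_of_real l)}"
      using w(1) eigenvalue_mult_matrix_inv[OF PD_invertible[OF A]] by blast
    fix l assume "l \<in> {l. eigenvalue (B ** matrix_inv A) (complex_of_real l)}"
    then obtain v where v: "v \<noteq> 0" "B *v v = l *\<^sub>R (A *v v)"
      using eigenvalue_mult_matrix_inv[OF PD_invertible[OF A]] by blast
    have "1 * inner v (A *v v) \<le> (M * l) * inner v (A *v v)" using bound[of v] v(2) by simp
    then have "1 \<le> M * l" using PD_pos[OF A v(1)] by (simp only: mult_le_cancel_right)
    then show "1 / M \<le> l" using M by (simp add: divide_simps mult.commute)
  qed
  then show ?thesis by (simp add: M_def)
qed

lemma eig_min_pos:
  "A \<in> PD \<Longrightarrow> B \<in> PD \<Longrightarrow> eig_min (B ** matrix_inv A) > 0"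
  by (simp add: eig_min_eq_inverse_eig_max eig_max_pos)

lemma eig_min_ge_iff:
  assumes A: "A \<in> PD" and B: "B \<in> PD"
  shows "t \<le> eig_min (B ** matrix_inv A)
    \<longleftrightarrow> (\<forall>x. t * inner x (A *v x) \<le> inner x (B *v x))"
\<comment> \<open>Inverting the inequality requires \<open>t > 0\<close>; for other \<open>t\<close>
  both sides hold by positivity.\<close>
proof (cases "t > 0")
  case True
  have "t \<le> eig_min (B ** matrix_inv A) \<longleftrightarrow> eig_max (A ** matrix_inv B) \<le> 1 / t"
    using True eig_max_pos[OF B A]
    by (simp add: eig_min_eq_inverse_eig_max[OF A B] divide_simps mult.commute)
  also have "\<dots> \<longleftrightarrow> (\<forall>x. t * inner x (A *v x) \<le> inner x (B *v x))"
    unfolding eig_max_le_iff[OF B PD_hermitian[OF A]]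
    using True by (simp add: pos_le_divide_eq mult.commute)
  finally show ?thesis .
next
  case False
  then have "t * inner x (A *v x) \<le> inner x (B *v x)" for x
    using PD_nonneg[OF A, of x] PD_nonneg[OF B, of x]
    by (meson mult_nonpos_nonneg not_le order_trans)
  then show ?thesis using eig_min_pos[OF A B] False by simp
qed

text \<open>Together with its dual, this derives equalities of extremal eigenvalues from the two
  form criteria without handling eigenvectors.\<close>

lemma eq_if_same_upper_bounds: "(\<And>t. a \<le> t \<longleftrightarrow> b \<le> t) \<Longrightarrow> a = (b::'a::order)"
  by (meson order_antisym order_refl)

lemma eq_if_same_lower_bounds: "(\<And>t. t \<le> a \<longleftrightarrow> t \<le> b) \<Longrightarrow> a = (b::'a::order)"
  by (meson order_antisym order_refl)

section \<open>The mean and square roots of extremal eigenvalues\<close>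

lemma eig_max_affine:
  fixes A B :: "complex ^ 'n ^ 'n"
  assumes A: "A \<in> PD" and B: "B \<in> PD" and "a > 0"
  shows "eig_max ((a *\<^sub>R B + b *\<^sub>R A) ** matrix_inv A) = a * eig_max (B ** matrix_inv A) + b"
proof (rule eq_if_same_upper_bounds)
  fix t
  have "eig_max ((a *\<^sub>R B + b *\<^sub>R A) ** matrix_inv A) \<le> t
      \<longleftrightarrow> (\<forall>x. a * inner x (B *v x) + b * inner x (A *v x) \<le> t * inner x (A *v x))"
    by (simp add: eig_max_le_iff[OF A hermitian_add_scaleR] PD_hermitian A B inner_add_right
        matrix_vector_mult_add_rdistrib matrix_vector_mult_scaleR_left)
  also have "\<dots> \<longleftrightarrow> (\<forall>x. inner x (B *v x) \<le> (t - b) / a * inner x (A *v x))"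
    using \<open>a > 0\<close> by (simp add: field_simps)
  also have "\<dots> \<longleftrightarrow> eig_max (B ** matrix_inv A) \<le> (t - b) / a"
    by (simp add: eig_max_le_iff[OF A PD_hermitian[OF B]])
  also have "\<dots> \<longleftrightarrow> a * eig_max (B ** matrix_inv A) + b \<le> t"
    using \<open>a > 0\<close> by (simp add: field_simps)
  finally show "eig_max ((a *\<^sub>R B + b *\<^sub>R A) ** matrix_inv A) \<le> t
      \<longleftrightarrow> a * eig_max (B ** matrix_inv A) + b \<le> t" .
qed

text \<open>The condition \<open>b > 0\<close>, absent from the version for the maximum, places the
  combination in \<open>PD\<close>, as \<open>eig_min_ge_iff\<close> demands.\<close>

lemma eig_min_affine:
  fixes A B :: "complex ^ 'n ^ 'n"
  assumes A: "A \<in> PD" and B: "B \<in> PD" and "a > 0" "b > 0"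
  shows "eig_min ((a *\<^sub>R B + b *\<^sub>R A) ** matrix_inv A) = a * eig_min (B ** matrix_inv A) + b"
proof (rule eq_if_same_lower_bounds)
  fix t
  have "t \<le> eig_min ((a *\<^sub>R B + b *\<^sub>R A) ** matrix_inv A)
      \<longleftrightarrow> (\<forall>x. t * inner x (A *v x) \<le> a * inner x (B *v x) + b * inner x (A *v x))"
    by (simp add: eig_min_ge_iff[OF A PD_add_scaleR] assms inner_add_right
        matrix_vector_mult_add_rdistrib matrix_vector_mult_scaleR_left)
  also have "\<dots> \<longleftrightarrow> (\<forall>x. (t - b) / a * inner x (A *v x) \<le> inner x (B *v x))"
    using \<open>a > 0\<close> by (simp add: field_simps)
  also have "\<dots> \<longleftrightarrow> (t - b) / a \<le> eig_min (B ** matrix_inv A)"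
    by (simp add: eig_min_ge_iff[OF A B])
  also have "\<dots> \<longleftrightarrow> t \<le> a * eig_min (B ** matrix_inv A) + b"
    using \<open>a > 0\<close> by (simp add: field_simps)
  finally show "t \<le> eig_min ((a *\<^sub>R B + b *\<^sub>R A) ** matrix_inv A)
      \<longleftrightarrow> t \<le> a * eig_min (B ** matrix_inv A) + b" .
qed

text \<open>The coefficients of the mean define the affine function interpolating the square root at
  \<open>m\<close> and \<open>M\<close>. They are symmetric in \<open>m\<close> and
  \<open>M\<close>, so one evaluation serves both endpoints.\<close>

lemma sqrt_midpoint_weights:
  fixes m M :: real
  assumes "m > 0" "M > 0"
  shows "1 / (sqrt m + sqrt M) * M + sqrt (m * M) / (sqrt m + sqrt M) = sqrt M"
proof -
  have "M + sqrt (m * M) = sqrt M * (sqrt m + sqrt M)"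
    using assms by (simp add: real_sqrt_mult algebra_simps)
  moreover have "sqrt m + sqrt M > 0" using assms by (simp add: add_pos_pos)
  ultimately show ?thesis by (simp flip: add_divide_distrib)
qed

lemma star_mean_eq:
  "star_mean A B =
    (1 / (sqrt (eig_min (B ** matrix_inv A)) + sqrt (eig_max (B ** matrix_inv A)))) *\<^sub>R B
    + (sqrt (eig_min (B ** matrix_inv A) * eig_max (B ** matrix_inv A))
       / (sqrt (eig_min (B ** matrix_inv A)) + sqrt (eig_max (B ** matrix_inv A)))) *\<^sub>R A"
  by (simp add: star_mean_def Let_def scaleR_add_right)

lemma star_mean_PD:
  assumes "A \<in> PD" "B \<in> PD" shows "star_mean A B \<in> PD"
  unfolding star_mean_eq using eig_min_pos[OF assms] eig_max_pos[OF assms]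
  by (intro PD_add_scaleR assms divide_pos_pos add_pos_pos) auto

text \<open>Exchanging the arguments replaces the square roots \<open>m\<close>, \<open>M\<close> by
  \<open>1 / M\<close>, \<open>1 / m\<close>; clearing denominators then shows that the two weights
  trade places.\<close>

lemma star_mean_commute:
  assumes A: "A \<in> PD" and B: "B \<in> PD"
  shows "star_mean A B = star_mean B A"
proof -
  define m where "m = sqrt (eig_min (B ** matrix_inv A))"
  define M where "M = sqrt (eig_max (B ** matrix_inv A))"
  have pos: "m > 0" "M > 0"
    using eig_min_pos[OF A B] eig_max_pos[OF A B] by (simp_all add: m_def M_def)
  have "sqrt (eig_min (A ** matrix_inv B)) = 1 / M" "sqrt (eig_max (A ** matrix_inv B)) = 1 / m"
    by (simp_all add: eig_min_eq_inverse_eig_max[OF A B] eig_min_eq_inverse_eig_max[OF B A]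
        m_def M_def real_sqrt_divide)
  then have BA: "star_mean B A = (1 / (1 / M + 1 / m)) *\<^sub>R A + (1 / M * (1 / m) / (1 / M + 1 / m)) *\<^sub>R B"
    unfolding star_mean_eq real_sqrt_mult by simp
  have AB: "star_mean A B = (1 / (m + M)) *\<^sub>R B + (m * M / (m + M)) *\<^sub>R A"
    unfolding star_mean_eq real_sqrt_mult m_def M_def ..
  have "m + M > 0" using pos by simp
  then have "1 / (1 / M + 1 / m) = m * M / (m + M)" "1 / M * (1 / m) / (1 / M + 1 / m) = 1 / (m + M)"
    using pos by (auto simp: field_simps)
  then show ?thesis unfolding AB BA by simp
qed

lemma eig_max_star_mean:
  assumes A: "A \<in> PD" and B: "B \<in> PD"
  shows "eig_max (star_mean A B ** matrix_inv A) = sqrt (eig_max (B ** matrix_inv A))"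
proof -
  have "1 / (sqrt (eig_min (B ** matrix_inv A)) + sqrt (eig_max (B ** matrix_inv A))) > 0"
    using eig_min_pos[OF A B] eig_max_pos[OF A B] by (simp add: add_pos_pos)
  from eig_max_affine[OF A B this] show ?thesis
    unfolding star_mean_eq
    by (simp only: sqrt_midpoint_weights[OF eig_min_pos[OF A B] eig_max_pos[OF A B]])
qed

lemma eig_min_star_mean:
  assumes A: "A \<in> PD" and B: "B \<in> PD"
  shows "eig_min (star_mean A B ** matrix_inv A) = sqrt (eig_min (B ** matrix_inv A))"
proof -
  let ?m = "eig_min (B ** matrix_inv A)" and ?M = "eig_max (B ** matrix_inv A)"
  have pos: "?m > 0" "?M > 0" using eig_min_pos[OF A B] eig_max_pos[OF A B] .
  then have "1 / (sqrt ?m + sqrt ?M) > 0" "sqrt (?m * ?M) / (sqrt ?m + sqrt ?M) > 0"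
    by (simp_all add: add_pos_pos)
  from eig_min_affine[OF A B this]
  have "eig_min (star_mean A B ** matrix_inv A)
      = 1 / (sqrt ?m + sqrt ?M) * ?m + sqrt (?m * ?M) / (sqrt ?m + sqrt ?M)"
    by (simp only: star_mean_eq)
  \<comment> \<open>Reordered so that the interpolation identity applies with \<open>?m\<close> and
    \<open>?M\<close> exchanged.\<close>
  also have "\<dots> = 1 / (sqrt ?M + sqrt ?m) * ?m + sqrt (?M * ?m) / (sqrt ?M + sqrt ?m)"
    by (simp only: mult.commute[of ?m ?M] add.commute[of "sqrt ?m"])
  also have "\<dots> = sqrt ?m" using sqrt_midpoint_weights pos by blast
  finally show ?thesis .
qed

section \<open>Thompson distance to the mean\<close>

lemma thompson_dist_eq:
  assumes "A \<in> PD" "B \<in> PD"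
  shows "thompson_dist A B
    = ln (max (1 / eig_min (B ** matrix_inv A)) (eig_max (B ** matrix_inv A)))"
  by (simp add: thompson_dist_def eig_min_eq_inverse_eig_max[OF assms])

lemma thompson_dist_commute: "thompson_dist A B = thompson_dist B A"
  by (simp add: thompson_dist_def max.commute)

text \<open>Relative to \<open>A\<close>, the mean has the square roots of the extremal eigenvalues
  of \<open>B\<close>. The monotone square root commutes with \<open>max\<close>, and the logarithm
  turns it into a factor of one half.\<close>

lemma thompson_dist_star_mean:
  assumes A: "A \<in> PD" and B: "B \<in> PD"
  shows "thompson_dist A (star_mean A B) = thompson_dist A B / 2"
proof -
  let ?m = "eig_min (B ** matrix_inv A)" and ?M = "eig_max (B ** matrix_inv A)"
  have "max (1 / sqrt ?m) (sqrt ?M) = sqrt (max (1 / ?m) ?M)"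
    using max_of_mono[of sqrt "1 / ?m" ?M] by (simp add: mono_def real_sqrt_divide)
  moreover have "max (1 / ?m) ?M > 0" using eig_max_pos[OF A B] by (simp add: less_max_iff_disj)
  ultimately show ?thesis
    by (simp add: thompson_dist_eq A B star_mean_PD eig_max_star_mean eig_min_star_mean ln_sqrt)
qed

section \<open>Invariance under congruence\<close>

text \<open>Since \<open>conj_transpose X\<close> is surjective, substituting it into both forms
  leaves their comparison over all vectors unchanged.\<close>

lemma eig_max_congruence:
  assumes A: "A \<in> PD" and B: "B \<in> PD" and X: "invertible X"
  shows "eig_max ((X ** B ** conj_transpose X) ** matrix_inv (X ** A ** conj_transpose X))
    = eig_max (B ** matrix_inv A)"
proof (rule eq_if_same_upper_bounds)
  fix t
  obtain Y where "Y ** X = mat 1" using X by (auto simp: invertible_def)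
  then have "conj_transpose X ** conj_transpose Y = mat 1"
    by (metis conj_transpose_mult conj_transpose_mat_1)
  then have "conj_transpose X *v (conj_transpose Y *v y) = y" for y
    by (simp add: matrix_vector_mul_assoc)
  then have "(\<forall>x. P (conj_transpose X *v x)) \<longleftrightarrow> (\<forall>y. P y)" for P
    by metis
  note surj = this[of "\<lambda>y. inner y (B *v y) \<le> t * inner y (A *v y)"]
  show "eig_max ((X ** B ** conj_transpose X) ** matrix_inv (X ** A ** conj_transpose X)) \<le> t
      \<longleftrightarrow> eig_max (B ** matrix_inv A) \<le> t"
    unfolding eig_max_le_iff[OF PD_congruence[OF A X] PD_hermitian[OF PD_congruence[OF B X]]]
      eig_max_le_iff[OF A PD_hermitian[OF B]] inner_congruence
    by (rule surj)
qed

lemma matrix_mult_scaleR: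
  fixes A :: "complex ^ 'n ^ 'm" and B :: "complex ^ 'k ^ 'n"
  shows "A ** (c *\<^sub>R B) = c *\<^sub>R (A ** B)" "(c *\<^sub>R A) ** B = c *\<^sub>R (A ** B)"
  by (simp_all add: matrix_matrix_mult_def vec_eq_iff scaleR_sum_right)

lemma matrix_mult_add_rdistrib:
  fixes A B :: "complex ^ 'n ^ 'm" and C :: "complex ^ 'k ^ 'n"
  shows "(A + B) ** C = A ** C + B ** C"
  by (simp add: matrix_matrix_mult_def vec_eq_iff sum.distrib distrib_right)

lemma star_mean_congruence:
  assumes A: "A \<in> PD" and B: "B \<in> PD" and X: "invertible X"
  shows "star_mean (X ** A ** conj_transpose X) (X ** B ** conj_transpose X)
    = X ** star_mean A B ** conj_transpose X"
proof -
  have "eig_min ((X ** B ** conj_transpose X) ** matrix_inv (X ** A ** conj_transpose X))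
      = eig_min (B ** matrix_inv A)"
    by (simp only: eig_min_eq_inverse_eig_max PD_congruence A B X eig_max_congruence)
  then show ?thesis
    unfolding star_mean_eq eig_max_congruence[OF assms]
    by (simp add: matrix_mult_scaleR matrix_add_ldistrib matrix_mult_add_rdistrib)
qed

section \<open>Order bounds and monotonicity\<close>

text \<open>Domination of \<open>A\<close> by \<open>B\<close> says that the least relative
  eigenvalue is at least 1, a property that square roots preserve.\<close>

lemma star_mean_ge_left:
  assumes A: "A \<in> PD" and B: "B \<in> PD" and le: "A \<preceq>\<^sub>L B"
  shows "A \<preceq>\<^sub>L star_mean A B"
proof -
  have "1 \<le> eig_min (B ** matrix_inv A)"
    using le by (simp add: eig_min_ge_iff[OF A B] loewner_le_iff PD_hermitian A B)
  then have "1 \<le> eig_min (star_mean A B ** matrix_inv A)"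
    by (simp add: eig_min_star_mean[OF A B])
  then show ?thesis
    by (simp add: eig_min_ge_iff[OF A star_mean_PD[OF A B]] loewner_le_iff PD_hermitian A B star_mean_PD)
qed

text \<open>By symmetry the mean can be measured relative to \<open>B\<close>, where the hypothesis
  bounds the largest relative eigenvalue of \<open>A\<close> by 1.\<close>

lemma star_mean_le_right:
  assumes A: "A \<in> PD" and B: "B \<in> PD" and le: "A \<preceq>\<^sub>L B"
  shows "star_mean A B \<preceq>\<^sub>L B"
proof -
  have "eig_max (A ** matrix_inv B) \<le> 1"
    using le by (simp add: eig_max_le_iff[OF B PD_hermitian[OF A]] loewner_le_iff PD_hermitian A B)
  then have "eig_max (star_mean B A ** matrix_inv B) \<le> 1"
    by (simp add: eig_max_star_mean[OF B A])
  then show ?thesis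
    by (simp add: star_mean_commute[OF A B] eig_max_le_iff[OF B PD_hermitian[OF star_mean_PD[OF B A]]]
        loewner_le_iff PD_hermitian A B star_mean_PD)
qed

lemma matrix_inv_mat_1: "matrix_inv (mat 1 :: complex ^ 'n ^ 'n) = mat 1"
  using matrix_inv_inverse(1)[OF PD_invertible[OF mat_1_PD]] by simp

lemma eig_max_mono:
  fixes A B C :: "complex ^ 'n ^ 'n"
  assumes A: "A \<in> PD" and B: "B \<in> PD" and C: "C \<in> PD" and le: "A \<preceq>\<^sub>L B"
  shows "eig_max (A ** matrix_inv C) \<le> eig_max (B ** matrix_inv C)"
  unfolding eig_max_le_iff[OF C PD_hermitian[OF A]]
proof
  fix x
  have "inner x (A *v x) \<le> inner x (B *v x)"
    using le by (simp add: loewner_le_iff PD_hermitian A B)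
  also have "\<dots> \<le> eig_max (B ** matrix_inv C) * inner x (C *v x)"
    using eig_max_le_iff[OF C PD_hermitian[OF B], of "eig_max (B ** matrix_inv C)"] by simp
  finally show "inner x (A *v x) \<le> eig_max (B ** matrix_inv C) * inner x (C *v x)" .
qed

lemma eig_min_mono:
  fixes A B C :: "complex ^ 'n ^ 'n"
  assumes A: "A \<in> PD" and B: "B \<in> PD" and C: "C \<in> PD" and le: "A \<preceq>\<^sub>L B"
  shows "eig_min (A ** matrix_inv C) \<le> eig_min (B ** matrix_inv C)"
  unfolding eig_min_ge_iff[OF C B]
proof
  fix x
  have "eig_min (A ** matrix_inv C) * inner x (C *v x) \<le> inner x (A *v x)"
    using eig_min_ge_iff[OF C A, of "eig_min (A ** matrix_inv C)"] by simp
  also have "\<dots> \<le> inner x (B *v x)"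
    using le by (simp add: loewner_le_iff PD_hermitian A B)
  finally show "eig_min (A ** matrix_inv C) * inner x (C *v x) \<le> inner x (B *v x)" .
qed

section \<open>Continuity of the extremal eigenvalues and of the mean\<close>

text \<open>The strict comparison fails at the zero vector, and restricting it to the unit sphere
  also supplies the compactness used for upper semicontinuity.\<close>

lemma eig_max_less_iff:
  assumes A: "A \<in> PD" and B: "hermitian B"
  shows "eig_max (B ** matrix_inv A) < t
    \<longleftrightarrow> (\<forall>x \<in> sphere 0 1. inner x (B *v x) < t * inner x (A *v x))"
proof -
  define M where "M = eig_max (B ** matrix_inv A)"
  obtain w where w: "w \<noteq> 0" "B *v w = M *\<^sub>R (A *v w)"
    and bound: "\<And>x. inner x (B *v x) \<le> M * inner x (A *v x)"
    using eig_max_pencil[OF A B] unfolding M_def by blast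
  have "inner x (B *v x) < t * inner x (A *v x)" if "M < t" "x \<in> sphere 0 1" for x
  proof -
    have "x \<noteq> 0" using that by auto
    then have "M * inner x (A *v x) < t * inner x (A *v x)"
      using PD_pos[OF A] that(1) by simp
    then show ?thesis using bound[of x] by linarith
  qed
  moreover have "M < t" if less: "\<forall>x \<in> sphere 0 1. inner x (B *v x) < t * inner x (A *v x)"
  proof -
    define v where "v = w /\<^sub>R norm w"
    have v: "v \<in> sphere 0 1" "B *v v = M *\<^sub>R (A *v v)"
      using w by (simp_all add: v_def matrix_vector_mult_scaleR_right)
    then have "M * inner v (A *v v) < t * inner v (A *v v)" using less by fastforce
    then show ?thesis using PD_nonneg[OF A, of v] by (meson mult_right_mono not_le)
  qed
  ultimately show ?thesis unfolding M_def by blast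
qed

text \<open>Lower semicontinuity comes from testing the forms on an extremal vector, upper
  semicontinuity from uniformity over the compact unit sphere.\<close>
lemma continuous_on_eig_max:
  "continuous_on ((PD :: (complex ^ 'n ^ 'n) set) \<times> PD)
    (\<lambda>P. eig_max (snd P ** matrix_inv (fst P)) :: real)" (is "continuous_on ?D ?f")
  unfolding continuous_on_def
proof
  fix P :: "(complex ^ 'n ^ 'n) \<times> (complex ^ 'n ^ 'n)"
  assume P: "P \<in> ?D"
  have PDs: "fst Q \<in> PD" "snd Q \<in> PD" "hermitian (snd Q)" if "Q \<in> ?D" for Q
    using that by (auto intro: PD_hermitian)
  let ?g = "\<lambda>c Q x. c * inner x (fst Q *v x) - inner x (snd Q *v x)"
  show "(?f \<longlongrightarrow> ?f P) (at P within ?D)"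
  proof (rule order_tendstoI)
    fix c assume "c < ?f P"
    then obtain w where w: "?g c P w < 0"
      using eig_max_le_iff[OF PDs(1,3)[OF P], of c] by (auto simp: not_le)
    have "continuous_on ?D (\<lambda>Q. ?g c Q w)" by (intro continuous_intros)
    then have "((\<lambda>Q. ?g c Q w) \<longlongrightarrow> ?g c P w) (at P within ?D)"
      using P by (auto simp: continuous_on_def)
    then have "\<forall>\<^sub>F Q in at P within ?D. ?g c Q w < 0"
      using w by (rule order_tendstoD)
    moreover have "\<forall>\<^sub>F Q in at P within ?D. Q \<in> ?D"
      by (simp add: eventually_at_filter)
    ultimately show "\<forall>\<^sub>F Q in at P within ?D. c < ?f Q"
    proof eventually_elim
      case (elim Q)
      then show ?case using eig_max_le_iff[OF PDs(1,3)[OF elim(2)], of c]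
        by (metis diff_ge_0_iff_ge not_le)
    qed
  next
    fix c assume "?f P < c"
    then have pos: "\<forall>x \<in> sphere 0 1. 0 < ?g c P x"
      using eig_max_less_iff[OF PDs(1,3)[OF P], of c] by simp
    have "continuous_on (sphere 0 1) (?g c P)" by (intro continuous_intros)
    moreover have "sphere (0 :: complex ^ 'n) 1 \<noteq> {}" by simp
    ultimately obtain z where z: "z \<in> sphere 0 1" "\<forall>x \<in> sphere 0 1. ?g c P z \<le> ?g c P x"
      using continuous_attains_inf[of "sphere 0 1" "?g c P"] by auto
    \<comment> \<open>The least slack of the strict inequality over the sphere; it is attained,
      hence positive, and a perturbation by at most \<open>e / 2\<close> cannot exhaust it.\<close>
    define e where "e = ?g c P z"
    have e: "e > 0" "\<forall>x \<in> sphere 0 1. e \<le> ?g c P x" using pos z by (auto simp: e_def)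
    have "continuous_on (?D \<times> sphere 0 1) (\<lambda>(Q, x). ?g c Q x)"
      unfolding case_prod_beta by (intro continuous_intros)
    \<comment> \<open>Joint continuity together with compactness in \<open>x\<close> gives one
      neighbourhood of \<open>P\<close> that works for all unit vectors.\<close>
    then obtain U where U: "P \<in> U" "open U"
      "\<forall>Q \<in> U \<inter> ?D. \<forall>x \<in> sphere 0 1. dist (?g c Q x) (?g c P x) \<le> e / 2"
      using continuous_on_prod_compactE[of ?D "sphere 0 1" "\<lambda>(Q, x). ?g c Q x" P "e / 2"] P e(1)
      by (metis (no_types, lifting) case_prod_conv compact_sphere half_gt_zero)
    have "\<forall>\<^sub>F Q in at P within ?D. Q \<in> U \<inter> ?D"
      using U(1,2) by (auto simp: eventually_at_topological)
    then show "\<forall>\<^sub>F Q in at P within ?D. ?f Q < c"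
    proof eventually_elim
      case (elim Q)
      have "0 < ?g c Q x" if "x \<in> sphere 0 1" for x
      proof -
        have "\<bar>?g c Q x - ?g c P x\<bar> \<le> e / 2" using U(3) elim that by (auto simp: dist_real_def)
        moreover have "e \<le> ?g c P x" using e(2) that by blast
        ultimately show ?thesis using e(1) by linarith
      qed
      then show ?case using eig_max_less_iff[OF PDs(1,3), of Q Q c] elim by simp
    qed
  qed
qed

text \<open>Composing with \<open>prod.swap\<close> and taking reciprocals reduces this to the
  largest eigenvalue.\<close>

lemma continuous_on_eig_min:
  "continuous_on (PD \<times> PD) (\<lambda>P. eig_min (snd P ** matrix_inv (fst P)) :: real)"
proof -
  have "continuous_on (PD \<times> PD)
      (\<lambda>P. eig_max (snd (prod.swap P) ** matrix_inv (fst (prod.swap P))) :: real)"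
    by (rule continuous_on_compose2[OF continuous_on_eig_max])
      (auto intro!: continuous_intros simp: prod.swap_def)
  moreover have "eig_max (fst P ** matrix_inv (snd P)) \<noteq> 0" if "P \<in> PD \<times> PD" for P
    using that eig_max_pos by (metis less_irrefl mem_Times_iff)
  ultimately have "continuous_on (PD \<times> PD) (\<lambda>P. 1 / eig_max (fst P ** matrix_inv (snd P)))"
    by (auto intro!: continuous_intros)
  then show ?thesis
    by (rule continuous_on_eq) (auto simp: eig_min_eq_inverse_eig_max)
qed

lemma continuous_on_star_mean:
  "continuous_on ((PD :: (complex ^ 'n ^ 'n) set) \<times> PD) (\<lambda>P. star_mean (fst P) (snd P))"
proof -
  have "sqrt (eig_min (snd P ** matrix_inv (fst P))) + sqrt (eig_max (snd P ** matrix_inv (fst P))) \<noteq> 0"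
    if "P \<in> PD \<times> PD" for P :: "(complex ^ 'n ^ 'n) \<times> (complex ^ 'n ^ 'n)"
    using that eig_min_pos[of "fst P" "snd P"] eig_max_pos[of "fst P" "snd P"]
    by (simp add: mem_Times_iff add_pos_pos less_imp_neq[symmetric])
  then show ?thesis
    unfolding star_mean_eq
    by (intro continuous_intros continuous_on_eig_min continuous_on_eig_max) auto
qed

text \<open>The values of \<open>\<mu>\<close> are prescribed only on \<open>PD\<close>; the first
  conjunct expresses that its codomain is again \<open>PD\<close>.\<close>

theorem theorem2p5:
  fixes \<mu> :: "complex ^ 'n ^ 'n \<Rightarrow> complex ^ 'n ^ 'n \<Rightarrow> complex ^ 'n ^ 'n"
  assumes \<mu>_eq: "\<And>A B. A \<in> PD \<Longrightarrow> B \<in> PD \<Longrightarrow> \<mu> A B = star_mean A B"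
  shows
    "(\<forall>A\<in>PD. \<forall>B\<in>PD. \<mu> A B \<in> PD)
     \<and> (\<forall>A\<in>PD. \<forall>B\<in>PD.
          thompson_dist A (\<mu> A B) = thompson_dist A B / 2
          \<and> thompson_dist B (\<mu> A B) = thompson_dist A B / 2)
     \<and> continuous_on (PD \<times> PD) (\<lambda>(A, B). \<mu> A B)
     \<and> (\<forall>A\<in>PD. \<forall>B\<in>PD. \<mu> A B = \<mu> B A)
     \<and> (\<forall>A\<in>PD. \<forall>B\<in>PD. \<forall>X. invertible X \<longrightarrow>
          \<mu> (X ** A ** conj_transpose X) (X ** B ** conj_transpose X)
            = X ** \<mu> A B ** conj_transpose X)
     \<and> (\<forall>A\<in>PD. \<forall>B\<in>PD. A \<preceq>\<^sub>L B \<longrightarrow> A \<preceq>\<^sub>L \<mu> A B \<and> \<mu> A B \<preceq>\<^sub>L B)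
     \<and> (\<forall>\<Sigma>1\<in>PD. \<forall>\<Sigma>2\<in>PD. \<Sigma>1 \<preceq>\<^sub>L \<Sigma>2 \<longrightarrow>
          eig_min (\<mu> (mat 1) \<Sigma>1) \<le> eig_min (\<mu> (mat 1) \<Sigma>2)
          \<and> eig_max (\<mu> (mat 1) \<Sigma>1) \<le> eig_max (\<mu> (mat 1) \<Sigma>2))"
proof -
  have cont: "continuous_on (PD \<times> PD) (\<lambda>(A, B). \<mu> A B)"
    by (rule continuous_on_eq[OF continuous_on_star_mean]) (auto simp: \<mu>_eq)
  have mid: "thompson_dist B (star_mean A B) = thompson_dist A B / 2"
    if "A \<in> PD" "B \<in> PD" for A B :: "complex ^ 'n ^ 'n"
    using that thompson_dist_star_mean[of B A] star_mean_commute[of A B] thompson_dist_commute[of A B]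
    by simp
  \<comment> \<open>As an equation this would be a permutative rewrite rule and destroy the form
    \<open>star_mean (mat 1) \<Sigma>\<close> used by \<open>mono\<close>.\<close>
  have comm: "star_mean A B = star_mean B A \<longleftrightarrow> True"
    if "A \<in> PD" "B \<in> PD" for A B :: "complex ^ 'n ^ 'n"
    using star_mean_commute[OF that] by simp
  \<comment> \<open>With \<open>mat 1\<close> as reference, the extremal eigenvalues of the mean are
    the square roots of those of \<open>S\<close> and \<open>T\<close>, which are themselves
    monotone in the Loewner order.\<close>
  have mono: "eig_min (star_mean (mat 1) S) \<le> eig_min (star_mean (mat 1) T)
      \<and> eig_max (star_mean (mat 1) S) \<le> eig_max (star_mean (mat 1) T)"
    if "S \<in> PD" "T \<in> PD" "S \<preceq>\<^sub>L T" for S T :: "complex ^ 'n ^ 'n"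
    using eig_min_mono[OF that(1,2) mat_1_PD that(3)] eig_max_mono[OF that(1,2) mat_1_PD that(3)]
      eig_min_star_mean[OF mat_1_PD that(1)] eig_min_star_mean[OF mat_1_PD that(2)]
      eig_max_star_mean[OF mat_1_PD that(1)] eig_max_star_mean[OF mat_1_PD that(2)]
    by (simp add: matrix_inv_mat_1)
  show ?thesis
    by (intro conjI cont ballI allI impI; simp add: \<mu>_eq star_mean_PD thompson_dist_star_mean mid
        star_mean_congruence PD_congruence star_mean_ge_left star_mean_le_right mat_1_PD mono comm)
qed

end
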